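(* Let $\mathcal{A}$ be a nonempty alphabet set (a discrete set, finite or infinite, or a metric space $(\mathcal{A},d)$), let $\Omega=\mathcal{A}^{\mathbb{N}}$ be the full shift space with shift map $\sigma$, and let $\overline{\sigma}$ be the induced map on the hyperspace $\mathcal{K}(\Omega)$ of nonempty compact subsets of $\Omega$. Then the set of periodic points of $(\mathcal{K}(\Omega),\overline{\sigma})$ is dense in $\mathcal{K}(\Omega)$.
   Context: Sequences in $\mathcal{A}^{\mathbb{N}}$ are indexed from $0$, and $\sigma(x_0x_1x_2\ldots)=x_1x_2x_3\ldots$. The space $\mathcal{A}^{\mathbb{N}}$ carries the metric $D$, where $D(\bar x,\bar y)=\sum_{i=0}^\infty \frac{\delta(x_i,y_i)}{2^i}$ ($\delta$ the discrete metric) if $\mathcal{A}$ is a discrete alphabet, and $D(\bar x,\bar y)=\sum_{i=0}^\infty \frac{1}{2^i}\frac{d(x_i,y_i)}{1+d(x_i,y_i)}$ if $\mathcal{A}$ is a general metric space $(\mathcal{A},d)$; both induce the product topology. $\mathcal{K}(\Omega)$ is the set of nonempty compact subsets of $\Omega$ with the Hausdorff metric $D_H$ induced by $D$, and $\overline{\sigma}(K)=\sigma(K)=\{\sigma(\bar x):\bar x\in K\}$. For a continuous $f:X\to X$, a point $x$ is periodic if $f^n(x)=x$ for some positive integer $n$. *)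

theory Defs
  imports "HOL-Analysis.Analysis"
begin

definition full_shift :: "'a set \<Rightarrow> (nat \<Rightarrow> 'a) set" where
  "full_shift A = {x. \<forall>i. x i \<in> A}"

definition shift :: "(nat \<Rightarrow> 'a) \<Rightarrow> nat \<Rightarrow> 'a" where
  "shift x = (\<lambda>i. x (Suc i))"

definition discrete_shift_dist :: "(nat \<Rightarrow> 'a) \<Rightarrow> (nat \<Rightarrow> 'a) \<Rightarrow> real" where
  "discrete_shift_dist x y = (\<Sum>i. discrete_metric.dd (x i) (y i) / 2 ^ i)"

definition metric_shift_dist ::
    "('a \<Rightarrow> 'a \<Rightarrow> real) \<Rightarrow> (nat \<Rightarrow> 'a) \<Rightarrow> (nat \<Rightarrow> 'a) \<Rightarrow> real" where
  "metric_shift_dist d x y = (\<Sum>i. (1 / 2 ^ i) * (d (x i) (y i) / (1 + d (x i) (y i))))"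

definition hyperspace :: "'a set \<Rightarrow> ('a \<Rightarrow> 'a \<Rightarrow> real) \<Rightarrow> 'a set set" where
  "hyperspace M d = {K. K \<noteq> {} \<and> compactin (Metric_space.mtopology M d) K}"

text \<open>The locale \<^locale>\<open>Metric_space\<close> demands nonnegativity and symmetry on the whole type, so the
  distance is extended by 0 to pairs outside the hyperspace (where the suprema may not exist).\<close>

definition hausdorff_dist :: "'a set \<Rightarrow> ('a \<Rightarrow> 'a \<Rightarrow> real) \<Rightarrow> 'a set \<Rightarrow> 'a set \<Rightarrow> real" where
  "hausdorff_dist M d K L =
     (if K \<in> hyperspace M d \<and> L \<in> hyperspace M d
      then max (SUP x\<in>K. INF y\<in>L. d x y) (SUP y\<in>L. INF x\<in>K. d x y)
      else 0)"

definition hyperspace_topology :: "'a set \<Rightarrow> ('a \<Rightarrow> 'a \<Rightarrow> real) \<Rightarrow> 'a set topology" where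
  "hyperspace_topology M d = Metric_space.mtopology (hyperspace M d) (hausdorff_dist M d)"

definition periodic_points :: "'a set \<Rightarrow> ('a \<Rightarrow> 'a) \<Rightarrow> 'a set" where
  "periodic_points X f = {x \<in> X. \<exists>n>0. (f ^^ n) x = x}"


text \<open>The distances above satisfy the axioms of \<^locale>\<open>Metric_space\<close>, so that the metric
  topologies above are the genuine ones.\<close>

lemma summable_bounded_half_powers:
  fixes r :: "nat \<Rightarrow> real"
  assumes "\<And>i. 0 \<le> r i" "\<And>i. r i \<le> 1"
  shows "summable (\<lambda>i. r i / 2 ^ i)"
proof (rule summable_comparison_test')
  show "summable (\<lambda>i. (1/2::real) ^ i)" by (rule summable_geometric) simp
  show "norm (r i / 2 ^ i) \<le> (1/2::real) ^ i" if "0 \<le> i" for i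
    using assms[of i] by (simp add: power_one_over divide_simps)
qed

lemma Metric_space_weighted_sum:
  fixes r :: "'a \<Rightarrow> 'a \<Rightarrow> real"
  assumes r: "Metric_space A r" and le: "\<And>a b. r a b \<le> 1"
  shows "Metric_space (full_shift A) (\<lambda>x y. \<Sum>i. r (x i) (y i) / 2 ^ i)"
proof -
  interpret Metric_space A r by (rule r)
  have S: "summable (\<lambda>i. r (x i) (y i) / 2 ^ i)" for x y :: "nat \<Rightarrow> 'a"
    by (rule summable_bounded_half_powers) (auto simp: le)
  show ?thesis
  proof
    fix x y :: "nat \<Rightarrow> 'a"
    show "0 \<le> (\<Sum>i. r (x i) (y i) / 2 ^ i)" by (intro suminf_nonneg S) simp
    show "(\<Sum>i. r (x i) (y i) / 2 ^ i) = (\<Sum>i. r (y i) (x i) / 2 ^ i)" by (simp add: commute)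
    assume "x \<in> full_shift A" "y \<in> full_shift A"
    then show "((\<Sum>i. r (x i) (y i) / 2 ^ i) = 0) = (x = y)"
      by (subst suminf_eq_zero_iff[OF S]) (auto simp: full_shift_def)
  next
    fix x y z :: "nat \<Rightarrow> 'a"
    assume xyz: "x \<in> full_shift A" "y \<in> full_shift A" "z \<in> full_shift A"
    have "(\<Sum>i. r (x i) (z i) / 2 ^ i) \<le> (\<Sum>i. r (x i) (y i) / 2 ^ i + r (y i) (z i) / 2 ^ i)"
    proof (intro suminf_le S summable_add)
      fix i
      have "r (x i) (z i) \<le> r (x i) (y i) + r (y i) (z i)"
        using xyz by (intro triangle) (auto simp: full_shift_def)
      then show "r (x i) (z i) / 2 ^ i \<le> r (x i) (y i) / 2 ^ i + r (y i) (z i) / 2 ^ i"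
        by (simp add: divide_right_mono flip: add_divide_distrib)
    qed
    then show "(\<Sum>i. r (x i) (z i) / 2 ^ i)
        \<le> (\<Sum>i. r (x i) (y i) / 2 ^ i) + (\<Sum>i. r (y i) (z i) / 2 ^ i)"
      by (simp add: suminf_add S)
  qed
qed

lemma Metric_space_discrete_shift_dist:
  "Metric_space (full_shift A) (discrete_shift_dist :: (nat \<Rightarrow> 'a) \<Rightarrow> _)"
  using Metric_space_weighted_sum[OF metric_M_dd discrete_metric.dd_le1]
  by (simp add: discrete_shift_dist_def[abs_def])

lemma bounded_transform_triangle:
  fixes a b c :: real
  assumes "0 \<le> a" "0 \<le> b" "0 \<le> c" "c \<le> a + b"
  shows "c / (1 + c) \<le> a / (1 + a) + b / (1 + b)"
proof -
  have "c / (1 + c) \<le> (a + b) / (1 + (a + b))"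
    using assms by (simp add: divide_simps algebra_simps)
  also have "\<dots> = a / (1 + (a + b)) + b / (1 + (a + b))" by (simp add: add_divide_distrib)
  also have "\<dots> \<le> a / (1 + a) + b / (1 + b)"
    using assms by (intro add_mono divide_left_mono) auto
  finally show ?thesis .
qed

lemma Metric_space_metric_shift_dist:
  assumes "Metric_space A d"
  shows "Metric_space (full_shift A) (metric_shift_dist d)"
proof -
  interpret Metric_space A d by (rule assms)
  have p: "1 + d a b > 0" for a b using nonneg[of a b] by linarith
  have "Metric_space A (\<lambda>a b. d a b / (1 + d a b))"
  proof
    fix x y
    show "0 \<le> d x y / (1 + d x y)" by (simp add: add_nonneg_nonneg)
    show "d x y / (1 + d x y) = d y x / (1 + d y x)" by (simp add: commute)
    show "(d x y / (1 + d x y) = 0) = (x = y)" if "x \<in> A" "y \<in> A"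
      using that p[of x y] by simp
  next
    fix x y z assume "x \<in> A" "y \<in> A" "z \<in> A"
    then show "d x z / (1 + d x z) \<le> d x y / (1 + d x y) + d y z / (1 + d y z)"
      by (intro bounded_transform_triangle nonneg triangle)
  qed
  moreover have "d a b / (1 + d a b) \<le> 1" for a b using p[of a b] by simp
  ultimately show ?thesis
    using Metric_space_weighted_sum[of A "\<lambda>a b. d a b / (1 + d a b)"]
    by (simp add: metric_shift_dist_def[abs_def] mult.commute)
qed

lemma Metric_space_hausdorff_dist:
  assumes "Metric_space M d"
  shows "Metric_space (hyperspace M d) (hausdorff_dist M d)"
proof -
  interpret Metric_space M d by (rule assms)
  define e where "e K L = (SUP x\<in>K. INF y\<in>L. d x y)" for K L
  have H: "hausdorff_dist M d K L = (if K \<in> hyperspace M d \<and> L \<in> hyperspace M d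
      then max (e K L) (e L K) else 0)" for K L
    unfolding hausdorff_dist_def e_def by (simp add: commute)
  have sub: "K \<subseteq> M" and ne: "K \<noteq> {}" and cp: "compactin mtopology K"
    if "K \<in> hyperspace M d" for K
    using that compactin_subset_topspace[of mtopology K] by (simp_all add: hyperspace_def)
  have bb: "bdd_below (d x ` L)" for x L by (intro bdd_belowI[of _ 0]) auto
  have inf_le: "(INF y\<in>L. d x y) \<le> d x y" if "y \<in> L" for x y L
    using that bb by (intro cINF_lower)
  have inf_nn: "0 \<le> (INF y\<in>L. d x y)" if "L \<noteq> {}" for x L
    using that by (intro cINF_greatest) auto
  have ba: "bdd_above ((\<lambda>x. INF y\<in>L. d x y) ` K)"
    if K: "K \<in> hyperspace M d" and L: "L \<in> hyperspace M d" for K L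
  proof -
    obtain y where y: "y \<in> L" using ne[OF L] by auto
    have "mbounded (insert y K)"
      using compactin_imp_mbounded[OF cp[OF K]] sub[OF L] y by (simp add: mbounded_insert subsetD)
    then obtain B where "\<And>u v. u \<in> insert y K \<Longrightarrow> v \<in> insert y K \<Longrightarrow> d u v \<le> B"
      unfolding mbounded_alt by blast
    then show ?thesis
      by (intro bdd_aboveI2[of _ _ B]) (meson inf_le[OF y] insertCI order_trans)
  qed
  have le_e: "(INF y\<in>L. d x y) \<le> e K L"
    if "K \<in> hyperspace M d" "L \<in> hyperspace M d" "x \<in> K" for x K L
    unfolding e_def using that ba by (intro cSUP_upper)
  have e_nn: "0 \<le> e K L" if "K \<in> hyperspace M d" "L \<in> hyperspace M d" for K L
    using ne[OF that(1)] le_e[OF that] inf_nn[OF ne[OF that(2)]] by (meson ex_in_conv order_trans)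
  have near: "\<exists>y\<in>L. d x y < e K L + \<epsilon>"
    if "K \<in> hyperspace M d" "L \<in> hyperspace M d" "x \<in> K" "0 < \<epsilon>" for x K L and \<epsilon> :: real
    using le_e[OF that(1-3)] that(4) cINF_less_iff[OF ne[OF that(2)] bb, of x "e K L + \<epsilon>"]
    by linarith
  have e_tri: "e K N \<le> e K L + e L N"
    if K: "K \<in> hyperspace M d" and L: "L \<in> hyperspace M d" and N: "N \<in> hyperspace M d" for K L N
  proof -
    have "(INF z\<in>N. d x z) \<le> e K L + e L N" if x: "x \<in> K" for x
    proof (rule field_le_epsilon)
      fix \<epsilon> :: real assume "0 < \<epsilon>"
      then have h: "0 < \<epsilon> / 2" by simp
      obtain y where y: "y \<in> L" "d x y < e K L + \<epsilon> / 2" using near[OF K L x h] by blast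
      obtain z where z: "z \<in> N" "d y z < e L N + \<epsilon> / 2" using near[OF L N y(1) h] by blast
      have "(INF z\<in>N. d x z) \<le> d x z" by (rule inf_le[OF z(1)])
      also have "\<dots> \<le> d x y + d y z"
        using sub[OF K] sub[OF L] sub[OF N] x y z by (intro triangle) auto
      finally show "(INF z\<in>N. d x z) \<le> e K L + e L N + \<epsilon>" using y z by linarith
    qed
    then show ?thesis unfolding e_def[of K N] using ne[OF K] by (intro cSUP_least)
  qed
  have e0: "K \<subseteq> L"
    if K: "K \<in> hyperspace M d" and L: "L \<in> hyperspace M d" and z: "e K L = 0" for K L
  proof
    fix x assume x: "x \<in> K"
    have cl: "closedin mtopology L"
      using compactin_imp_closedin[OF Hausdorff_space_mtopology cp[OF L]] .
    show "x \<in> L"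
    proof (rule ccontr)
      assume "x \<notin> L"
      then obtain \<epsilon> where \<epsilon>: "\<epsilon> > 0" "disjnt L (mball x \<epsilon>)"
        using cl sub[OF K] x unfolding closedin_metric by auto
      obtain y where "y \<in> L" "d x y < \<epsilon>" using near[OF K L x \<epsilon>(1)] z by auto
      then show False using \<epsilon> sub[OF K] sub[OF L] x by (auto simp: disjnt_iff)
    qed
  qed
  have e_self: "e K K = 0" if "K \<in> hyperspace M d" for K
  proof -
    have "(INF y\<in>K. d x y) \<le> 0" if "x \<in> K" for x
      using inf_le[OF that, of x] sub[OF \<open>K \<in> hyperspace M d\<close>] that by (auto simp: subsetD)
    then have "e K K \<le> 0" unfolding e_def using ne[OF that] by (intro cSUP_least)
    then show ?thesis using e_nn[OF that that] by simp
  qed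
  show ?thesis
  proof
    fix K L
    show "0 \<le> hausdorff_dist M d K L" using e_nn by (auto simp: H le_max_iff_disj)
    show "hausdorff_dist M d K L = hausdorff_dist M d L K" by (simp add: H max.commute)
    assume KL: "K \<in> hyperspace M d" "L \<in> hyperspace M d"
    show "(hausdorff_dist M d K L = 0) = (K = L)"
    proof
      assume "hausdorff_dist M d K L = 0"
      then have "e K L = 0" "e L K = 0"
        using KL e_nn[OF KL] e_nn[OF KL(2,1)] by (auto simp: H max_def split: if_splits)
      then show "K = L" using e0 KL by blast
    qed (use KL e_self in \<open>simp add: H\<close>)
  next
    fix K L N assume "K \<in> hyperspace M d" "L \<in> hyperspace M d" "N \<in> hyperspace M d"
    then show "hausdorff_dist M d K N \<le> hausdorff_dist M d K L + hausdorff_dist M d L N"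
      using e_tri[of K L N] e_tri[of N L K] by (simp add: H) linarith
  qed
qed

end

theory Submission
  imports Defs
begin

text \<open>A compact set \<open>K\<close> is approximated by a finite set \<open>F \<subseteq> K\<close>. Repeating the initial block of
  length \<open>n\<close> of each point of \<open>F\<close> moves that point by at most \<open>2 / 2 ^ n\<close> and makes it a fixed point
  of the \<open>n\<close>-th iterate of the shift, so the finite set of these repetitions is a periodic point of
  the induced map close to \<open>K\<close>.\<close>

definition periodize :: "nat \<Rightarrow> (nat \<Rightarrow> 'a) \<Rightarrow> nat \<Rightarrow> 'a" where
  "periodize n x = (\<lambda>i. x (i mod n))"

lemma periodize_in_full_shift: "x \<in> full_shift A \<Longrightarrow> periodize n x \<in> full_shift A"
  by (simp add: periodize_def full_shift_def)

lemma periodize_nth: "i < n \<Longrightarrow> periodize n x i = x i"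
  by (simp add: periodize_def)

lemma funpow_shift: "(shift ^^ n) x = (\<lambda>i. x (i + n))"
  by (induction n) (simp_all add: shift_def)

text \<open>Adding \<open>n\<close> to an index keeps its residue mod \<open>n\<close>. At
  \<open>n = 0\<close> the convention \<open>i mod 0 = i\<close> makes \<open>periodize\<close> the
  identity.\<close>

lemma funpow_shift_periodize: "(shift ^^ n) (periodize n x) = periodize n x"
  by (simp add: funpow_shift periodize_def)

lemma funpow_image:
  fixes f :: "'a \<Rightarrow> 'a"
  shows "(image f ^^ n) S = (f ^^ n) ` S"
  by (induction n) (simp_all add: image_comp)

lemma funpow_image_shift_periodize:
  "(image shift ^^ n) (periodize n ` F) = periodize n ` F"
  by (simp add: funpow_image image_image funpow_shift_periodize)

text \<open>A witness within \<open>e\<close> bounds each infimum by \<open>e\<close>, and the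
  suprema over the nonempty sets \<open>K\<close> and \<open>L\<close> inherit the bound. Only the
  non-strict inequality survives a supremum.\<close>

lemma hausdorff_dist_le:
  assumes "Metric_space M d" "K \<in> hyperspace M d" "L \<in> hyperspace M d"
    and KL: "\<And>x. x \<in> K \<Longrightarrow> \<exists>y\<in>L. d x y \<le> e" and LK: "\<And>y. y \<in> L \<Longrightarrow> \<exists>x\<in>K. d x y \<le> e"
  shows "hausdorff_dist M d K L \<le> e"
proof -
  interpret Metric_space M d by (rule assms(1))
  have ne: "K \<noteq> {}" "L \<noteq> {}" using assms(2,3) by (simp_all add: hyperspace_def)
  have bb: "bdd_below (d x ` S)" "bdd_below ((\<lambda>y. d y x) ` S)" for x S
    by (auto intro!: bdd_belowI[of _ 0])
  have "(INF y\<in>L. d x y) \<le> e" if "x \<in> K" for x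
    using KL[OF that] cINF_lower2[OF bb(1)] by blast
  moreover have "(INF x\<in>K. d x y) \<le> e" if "y \<in> L" for y
    using LK[OF that] cINF_lower2[OF bb(2)] by blast
  ultimately have "(SUP x\<in>K. INF y\<in>L. d x y) \<le> e" "(SUP y\<in>L. INF x\<in>K. d x y) \<le> e"
    using ne by (simp_all add: cSUP_least)
  then show ?thesis using assms(2,3) by (simp add: hausdorff_dist_def)
qed

lemma finite_in_hyperspace:
  assumes "Metric_space M d" "finite F" "F \<subseteq> M" "F \<noteq> {}"
  shows "F \<in> hyperspace M d"
  using assms
  by (simp add: hyperspace_def finite_imp_compactin Metric_space.topspace_mtopology)

text \<open>The first \<open>n\<close> terms vanish and the tail is dominated by a geometric series.
  A general \<open>r\<close> with values in [0,1] covers both the discrete metric and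
  \<open>d / (1 + d)\<close>.\<close>

lemma weighted_sum_le_if_agree:
  fixes r :: "'a \<Rightarrow> 'a \<Rightarrow> real"
  assumes r: "\<And>a b. 0 \<le> r a b" "\<And>a b. r a b \<le> 1"
    and eq: "\<And>i. i < n \<Longrightarrow> r (x i) (y i) = 0"
  shows "(\<Sum>i. r (x i) (y i) / 2 ^ i) \<le> 2 * (1/2) ^ n"
proof -
  have S: "summable (\<lambda>i. r (x i) (y i) / 2 ^ i)"
    using r by (intro summable_bounded_half_powers)
  have "(\<Sum>i. r (x i) (y i) / 2 ^ i) = (\<Sum>i. r (x (i + n)) (y (i + n)) / 2 ^ (i + n))"
    using suminf_split_initial_segment[OF S, of n] eq by simp
  also have "\<dots> \<le> (\<Sum>i. (1/2) ^ n * (1/2) ^ i)"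
  proof (rule suminf_le)
    show "summable (\<lambda>i. r (x (i + n)) (y (i + n)) / 2 ^ (i + n))"
      using S by (rule summable_ignore_initial_segment)
    show "r (x (i + n)) (y (i + n)) / 2 ^ (i + n) \<le> (1/2) ^ n * (1/2) ^ i" for i
      using r(2) by (simp add: power_one_over power_add divide_simps)
  qed (intro summable_mult summable_geometric, simp)
  also have "\<dots> = 2 * (1/2) ^ n"
    by (subst suminf_mult) (simp_all add: suminf_geometric summable_geometric)
  finally show ?thesis .
qed

lemma discrete_shift_dist_le_if_agree:
  assumes "\<And>i. i < n \<Longrightarrow> x i = y i"
  shows "discrete_shift_dist x y \<le> 2 * (1/2) ^ n"
  unfolding discrete_shift_dist_def using assms
  by (intro weighted_sum_le_if_agree) (auto simp: discrete_metric.dd_def)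

lemma metric_shift_dist_le_if_agree:
  assumes "Metric_space A d" "x \<in> full_shift A" "\<And>i. i < n \<Longrightarrow> x i = y i"
  shows "metric_shift_dist d x y \<le> 2 * (1/2) ^ n"
proof -
  interpret Metric_space A d by (rule assms(1))
  have p: "0 < 1 + d a b" for a b using nonneg[of a b] by linarith
  \<comment> \<open>The axioms make \<open>d\<close> vanish on the diagonal only over
    \<open>A\<close>, so this uses that \<open>x i\<close> lies in \<open>A\<close>.\<close>
  have "d (x i) (y i) = 0" if "i < n" for i
    using assms(2) by (simp add: full_shift_def flip: assms(3)[OF that])
  then have "(\<Sum>i. d (x i) (y i) / (1 + d (x i) (y i)) / 2 ^ i) \<le> 2 * (1/2) ^ n"
    using p by (intro weighted_sum_le_if_agree) (simp_all add: less_imp_le)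
  then show ?thesis by (simp add: metric_shift_dist_def mult.commute)
qed

text \<open>The argument sees \<open>D\<close> only through the metric axioms and
  \<open>agree\<close>, which treats both kinds of alphabet at once.\<close>

lemma ex_periodic_point_near:
  assumes D: "Metric_space (full_shift A) D"
    and agree: "\<And>n x y. x \<in> full_shift A \<Longrightarrow> (\<And>i. i < n \<Longrightarrow> x i = y i) \<Longrightarrow> D x y \<le> 2 * (1/2) ^ n"
    and K: "K \<in> hyperspace (full_shift A) D" and "0 < e"
  shows "\<exists>L \<in> periodic_points (hyperspace (full_shift A) D) (image shift).
           hausdorff_dist (full_shift A) D K L < e"
proof -
  interpret Metric_space "full_shift A" D by (rule D)
  have KM: "K \<subseteq> full_shift A" and "K \<noteq> {}" and cK: "compactin mtopology K"
    using K compactin_subset_topspace[of mtopology K] by (simp_all add: hyperspace_def)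
  have e4: "0 < e / 4" using \<open>0 < e\<close> by simp
  \<comment> \<open>Compact sets are totally bounded, with the centres of the balls chosen in
    \<open>K\<close> itself.\<close>
  obtain F where F: "finite F" "F \<subseteq> K" "K \<subseteq> (\<Union>x\<in>F. mball x (e / 4))"
    using compactin_imp_mtotally_bounded[OF cK, unfolded mtotally_bounded_def, rule_format, OF e4]
    by auto
  obtain m where "(1/2::real) ^ m < e / 8"
    using real_arch_pow_inv[of "e / 8" "1/2"] \<open>0 < e\<close> by auto
  \<comment> \<open>The successor makes the period positive, and its factor 1/2 cancels the 2 in
    \<open>agree\<close>.\<close>
  define n where "n = Suc m"
  have n: "2 * (1/2::real) ^ n < e / 4" "0 < n"
    using \<open>(1/2) ^ m < e / 8\<close> e4 by (simp_all add: n_def)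
  have near: "D x (periodize n x) < e / 4" if "x \<in> full_shift A" for x
    using agree[OF that, of n "periodize n x"] n(1) by (simp add: periodize_nth)
  define L where "L = periodize n ` F"
  have "F \<noteq> {}" using F(3) \<open>K \<noteq> {}\<close> by auto
  then have L: "L \<in> hyperspace (full_shift A) D"
    using F KM unfolding L_def
    by (intro finite_in_hyperspace D) (auto intro: periodize_in_full_shift)
  \<comment> \<open>The slack between \<open>e / 2\<close> and \<open>e\<close> restores the strict
    inequality lost in the suprema.\<close>
  have "hausdorff_dist (full_shift A) D K L \<le> e / 2"
  proof (rule hausdorff_dist_le[OF D K L])
    fix x assume x: "x \<in> K"
    then obtain z where z: "z \<in> F" "D z x < e / 4" using F(3) by auto
    have M: "x \<in> full_shift A" "z \<in> full_shift A" using x z F(2) KM by auto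
    \<comment> \<open>Pass through the centre \<open>z\<close>: covering and periodizing cost less
      than \<open>e / 4\<close> each.\<close>
    have "D x (periodize n z) \<le> D x z + D z (periodize n z)"
      using M by (intro triangle periodize_in_full_shift)
    then have "D x (periodize n z) \<le> e / 2"
      using z(2) near[OF M(2)] by (simp add: commute)
    then show "\<exists>y\<in>L. D x y \<le> e / 2" using z(1) by (auto simp: L_def)
  next
    fix y assume "y \<in> L"
    \<comment> \<open>The point \<open>z\<close> that was periodized lies in \<open>K\<close> and is
      itself the required witness.\<close>
    then obtain z where z: "z \<in> F" "y = periodize n z" by (auto simp: L_def)
    then have "D z y \<le> e / 2" using near[of z] F(2) KM \<open>0 < e\<close> by (fastforce intro: less_imp_le)
    then show "\<exists>x\<in>K. D x y \<le> e / 2" using z F(2) by auto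
  qed
  moreover have "L \<in> periodic_points (hyperspace (full_shift A) D) (image shift)"
    using L n(2) funpow_image_shift_periodize[of n F] unfolding periodic_points_def L_def by blast
  ultimately show ?thesis using \<open>0 < e\<close> by (intro bexI[of _ L]) auto
qed

theorem proposition3p1:
  fixes A :: "'a set" and D :: "(nat \<Rightarrow> 'a) \<Rightarrow> (nat \<Rightarrow> 'a) \<Rightarrow> real"
  assumes "A \<noteq> {}"
    and "D = discrete_shift_dist \<or> (\<exists>d. Metric_space A d \<and> D = metric_shift_dist d)"
  shows "hyperspace_topology (full_shift A) D closure_of
           periodic_points (hyperspace (full_shift A) D) (image shift)
         = hyperspace (full_shift A) D"
proof -
  have D: "Metric_space (full_shift A) D"
    using assms(2) Metric_space_discrete_shift_dist Metric_space_metric_shift_dist by auto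
  have agree: "D x y \<le> 2 * (1/2) ^ n"
    if "x \<in> full_shift A" "\<And>i. i < n \<Longrightarrow> x i = y i" for n x y
    using assms(2) that discrete_shift_dist_le_if_agree[of n x y]
      metric_shift_dist_le_if_agree[of A _ x n y] by blast
  interpret H: Metric_space "hyperspace (full_shift A) D" "hausdorff_dist (full_shift A) D"
    by (rule Metric_space_hausdorff_dist[OF D])
  let ?P = "periodic_points (hyperspace (full_shift A) D) (image shift)"
  have "?P \<subseteq> hyperspace (full_shift A) D" by (auto simp: periodic_points_def)
  \<comment> \<open>In a metric space, closure membership means that every ball around
    \<open>K\<close> meets \<open>?P\<close>. The reverse inclusion holds since a closure stays
    inside the space.\<close>
  then have "K \<in> H.mtopology closure_of ?P" if K: "K \<in> hyperspace (full_shift A) D" for K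
    using K ex_periodic_point_near[OF D agree K]
    unfolding H.metric_closure_of by (fastforce simp: H.in_mball)
  then show ?thesis
    unfolding hyperspace_topology_def using H.metric_closure_of by blast
qed

end
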